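(* Let $n\geq 1$ be an integer and let $\mathrm{sna}(n,\mathbb{C})$ be the set of all traceless complex $(n+1)\times(n+1)$ matrices in which the entries of every row and of every column sum to one, i.e. $$\mathrm{sna}(n,\mathbb{C}) := \Big\{a\in \mathrm{sl}(n+1,\mathbb{C}) \;\Big|\; \forall j\in\{1,\dots,n+1\},\ \sum_{i=1}^{n+1}a_{ij} = 1=\sum_{i=1}^{n+1}a_{ji} \Big\}.$$ Then $\mathrm{sna}(n,\mathbb{C})$ is an $(n^2-1)$-dimensional Lie affgebra over $\mathbb{C}$ with the affine space structure $$\langle a,b,c\rangle = a-b+c,\qquad \lambda\triangleright_a b = \lambda b+(1-\lambda)a,$$ and the Lie bracket $$[a,b]=ab-ba+b,$$ for all $a,b,c\in \mathrm{sna}(n,\mathbb{C})$ and $\lambda\in\mathbb{C}$, where addition, subtraction, multiplication and multiplication by scalars on the right-hand sides are the standard operations on matrices.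
   Context: $\mathrm{sl}(m,\mathbb{C})$ denotes the Lie algebra of traceless complex $m\times m$ matrices with the commutator bracket. Affine space (intrinsic definition). An affine space over a field $\mathbb{F}$ is a set $A$ with operations $\langle -,-,-\rangle: A^3\to A$ and $\mathbb{F}\times A\times A\to A$, $(\lambda,a,b)\mapsto \lambda\triangleright_a b$, such that for all $a,b,c,d,e\in A$ and $\lambda,\mu,\nu\in\mathbb{F}$: - (abelian heap) $\langle\langle a,b,c\rangle,d,e\rangle=\langle a,b,\langle c,d,e\rangle\rangle$, $\langle a,a,b\rangle=b$, $\langle a,b,c\rangle=\langle c,b,a\rangle$; - $(\lambda-\mu+\nu)\triangleright_a b=\langle\lambda\triangleright_a b,\mu\triangleright_a b,\nu\triangleright_a b\rangle$ and $\lambda\triangleright_a\langle b,c,d\rangle=\langle\lambda\triangleright_a b,\lambda\triangleright_a c,\lambda\triangleright_a d\rangle$; - $(\lambda\mu)\triangleright_a b=\lambda\triangleright_a(\mu\triangleright_a b)$, $1\triangleright_a b=b$, $0\triangleright_a b=a$; - $\lambda\triangleright_a b=\langle\lambda\triangleright_c b,\lambda\triangleright_c a,a\rangle$. Because of the heap axioms, the placement of internal brackets among an odd number of elements does not matter, so one writes $\langle a,b,c,d,e\rangle:=\langle\langle a,b,c\rangle,d,e\rangle$. An affine map $f:A\to B$ is a function with $f(\langle a,b,c\rangle)=\langle f(a),f(b),f(c)\rangle$ and $f(\lambda\triangleright_a b)=\lambda\triangleright_{f(a)}f(b)$ for all $a,b,c\in A$, $\lambda\in\mathbb{F}$. A bi-affine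 operation $A\times A\to A$ is one that is affine in each argument separately. For any $o\in A$, $A$ becomes an $\mathbb{F}$-vector space, denoted $\mathcal{V}(A_o)$, with addition $(a,b)\mapsto\langle a,o,b\rangle$, zero $o$, and scalar multiplication $(\lambda,a)\mapsto\lambda\triangleright_o a$; different choices of $o$ give isomorphic vector spaces. The dimension of a (non-empty) affine space $A$ is the dimension of any of the vector spaces $\mathcal{V}(A_o)$. Lie affgebra. A Lie bracket on an affine space $A$ is a bi-affine operation $[-,-]:A\times A\to A$ such that for all $a,b,c\in A$, $$\big\langle [a,b],[a,a],[b,a]\big\rangle=[b,b],$$ $$\big\langle [a,[b,c]],[a,a],[b,[c,a]],[b,b],[c,[a,b]]\big\rangle=[c,c].$$ An affine space with a specified Lie bracket is called a Lie affgebra. *)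

theory Defs
  imports "Jordan_Normal_Form.VS_Connect"
begin

section \<open>Affine spaces\<close>

text \<open>
  The carrier \<open>A\<close> may be empty. \<open>heap a b c\<close> is $\langle a,b,c\rangle$ and \<open>act l a b\<close>
  is $\lambda\triangleright_a b$.
\<close>

locale affine_space =
  fixes A :: "'a set"
    and heap :: "'a \<Rightarrow> 'a \<Rightarrow> 'a \<Rightarrow> 'a"
    and act :: "'f::field \<Rightarrow> 'a \<Rightarrow> 'a \<Rightarrow> 'a"
  assumes heap_closed: "\<lbrakk>a \<in> A; b \<in> A; c \<in> A\<rbrakk> \<Longrightarrow> heap a b c \<in> A"
    and act_closed: "\<lbrakk>a \<in> A; b \<in> A\<rbrakk> \<Longrightarrow> act l a b \<in> A"
    and heap_assoc: "\<lbrakk>a \<in> A; b \<in> A; c \<in> A; d \<in> A; e \<in> A\<rbrakk> \<Longrightarrow>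
          heap (heap a b c) d e = heap a b (heap c d e)"
    and heap_cancel: "\<lbrakk>a \<in> A; b \<in> A\<rbrakk> \<Longrightarrow> heap a a b = b"
    and heap_commute: "\<lbrakk>a \<in> A; b \<in> A; c \<in> A\<rbrakk> \<Longrightarrow> heap a b c = heap c b a"
    and act_heap_scalar: "\<lbrakk>a \<in> A; b \<in> A\<rbrakk> \<Longrightarrow>
          act (l - m + k) a b = heap (act l a b) (act m a b) (act k a b)"
    and act_heap: "\<lbrakk>a \<in> A; b \<in> A; c \<in> A; d \<in> A\<rbrakk> \<Longrightarrow>
          act l a (heap b c d) = heap (act l a b) (act l a c) (act l a d)"
    and act_mult: "\<lbrakk>a \<in> A; b \<in> A\<rbrakk> \<Longrightarrow> act (l * m) a b = act l a (act m a b)"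
    and act_one: "\<lbrakk>a \<in> A; b \<in> A\<rbrakk> \<Longrightarrow> act 1 a b = b"
    and act_zero: "\<lbrakk>a \<in> A; b \<in> A\<rbrakk> \<Longrightarrow> act 0 a b = a"
    and act_base_change: "\<lbrakk>a \<in> A; b \<in> A; c \<in> A\<rbrakk> \<Longrightarrow>
          act l a b = heap (act l c b) (act l c a) a"

definition affine_map ::
  "'a set \<Rightarrow> ('a \<Rightarrow> 'a \<Rightarrow> 'a \<Rightarrow> 'a) \<Rightarrow> ('f::field \<Rightarrow> 'a \<Rightarrow> 'a \<Rightarrow> 'a) \<Rightarrow>
   'b set \<Rightarrow> ('b \<Rightarrow> 'b \<Rightarrow> 'b \<Rightarrow> 'b) \<Rightarrow> ('f \<Rightarrow> 'b \<Rightarrow> 'b \<Rightarrow> 'b) \<Rightarrow> ('a \<Rightarrow> 'b) \<Rightarrow> bool"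
  where "affine_map A heap act B heap' act' f \<longleftrightarrow>
    f \<in> A \<rightarrow> B \<and>
    (\<forall>a\<in>A. \<forall>b\<in>A. \<forall>c\<in>A. f (heap a b c) = heap' (f a) (f b) (f c)) \<and>
    (\<forall>l. \<forall>a\<in>A. \<forall>b\<in>A. f (act l a b) = act' l (f a) (f b))"

definition bi_affine ::
  "'a set \<Rightarrow> ('a \<Rightarrow> 'a \<Rightarrow> 'a \<Rightarrow> 'a) \<Rightarrow> ('f::field \<Rightarrow> 'a \<Rightarrow> 'a \<Rightarrow> 'a) \<Rightarrow> ('a \<Rightarrow> 'a \<Rightarrow> 'a) \<Rightarrow> bool"
  where "bi_affine A heap act g \<longleftrightarrow>
    (\<forall>a\<in>A. affine_map A heap act A heap act (\<lambda>b. g a b)) \<and>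
    (\<forall>b\<in>A. affine_map A heap act A heap act (\<lambda>a. g a b))"

text \<open>
  The vector space $\mathcal{V}(A_p)$. The fields \<open>mult\<close> and \<open>one\<close>, which the record type
  inherits from rings, are not used by the theory of modules.
\<close>

definition tangent_space ::
  "'a set \<Rightarrow> ('a \<Rightarrow> 'a \<Rightarrow> 'a \<Rightarrow> 'a) \<Rightarrow> ('f::field \<Rightarrow> 'a \<Rightarrow> 'a \<Rightarrow> 'a) \<Rightarrow> 'a \<Rightarrow> ('f, 'a) module"
  where "tangent_space A heap act p =
    \<lparr>carrier = A, mult = undefined, one = undefined, zero = p,
     add = (\<lambda>a b. heap a p b), smult = (\<lambda>l a. act l p a)\<rparr>"

lemma (in affine_space) vectorspace_tangent_space:
  assumes p: "p \<in> A"
  shows "vectorspace (class_ring :: 'f ring) (tangent_space A heap act p)"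
proof -
  let ?V = "tangent_space A heap act p"
  have act_base: "act l p p = p" for l
    using act_mult[OF p p, of l 0] act_zero[OF p p] by simp
  have neg: "heap (heap p a p) p a = p" if "a \<in> A" for a
    using that p by (metis heap_assoc heap_cancel heap_commute)
  have grp: "abelian_group ?V"
  proof (rule abelian_groupI)
    show "\<exists>y\<in>carrier ?V. y \<oplus>\<^bsub>?V\<^esub> x = \<zero>\<^bsub>?V\<^esub>" if "x \<in> carrier ?V" for x
      using that p neg[of x] heap_closed[of p x p] by (auto simp: tangent_space_def)
    show "x \<oplus>\<^bsub>?V\<^esub> y = y \<oplus>\<^bsub>?V\<^esub> x" if "x \<in> carrier ?V" "y \<in> carrier ?V" for x y
      using that heap_commute[of x p y] p by (simp add: tangent_space_def)
  qed (use p in \<open>auto simp: tangent_space_def heap_closed heap_assoc heap_cancel\<close>)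
  have distr: "act (l + m) p x = heap (act l p x) p (act m p x)" if "x \<in> A" for l m x
    using act_heap_scalar[OF p that, of l 0 m] act_zero[OF p that] by simp
  have "module (class_ring :: 'f ring) ?V"
    by (rule moduleI)
      (use p grp in \<open>auto simp: tangent_space_def act_closed act_mult act_one act_heap act_base distr
        class_cring.is_cring\<close>)
  then show ?thesis
    unfolding vectorspace_def using class_field by blast
qed

text \<open>
  \<open>vectorspace.dim\<close> is only meaningful together with \<open>vectorspace.fin_dim\<close>. All base points
  have to give the same dimension \<open>d\<close>.
\<close>

definition has_affine_dim ::
  "'a set \<Rightarrow> ('a \<Rightarrow> 'a \<Rightarrow> 'a \<Rightarrow> 'a) \<Rightarrow> ('f::field \<Rightarrow> 'a \<Rightarrow> 'a \<Rightarrow> 'a) \<Rightarrow> nat \<Rightarrow> bool"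
  where "has_affine_dim A heap act d \<longleftrightarrow>
    A \<noteq> {} \<and>
    (\<forall>p\<in>A. vectorspace.fin_dim (class_ring :: 'f ring) (tangent_space A heap act p) \<and>
      vectorspace.dim (class_ring :: 'f ring) (tangent_space A heap act p) = d)"

section \<open>Lie affgebras\<close>

text \<open>
  The five-term bracket $\langle a,b,c,d,e\rangle$ of the Jacobi identity is
  \<open>heap (heap a b c) d e\<close>.
\<close>

locale lie_affgebra = affine_space A heap act
  for A :: "'a set"
    and heap :: "'a \<Rightarrow> 'a \<Rightarrow> 'a \<Rightarrow> 'a"
    and act :: "'f::field \<Rightarrow> 'a \<Rightarrow> 'a \<Rightarrow> 'a" +
  fixes br :: "'a \<Rightarrow> 'a \<Rightarrow> 'a"
  assumes br_bi_affine: "bi_affine A heap act br"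
    and br_antisym: "\<lbrakk>a \<in> A; b \<in> A\<rbrakk> \<Longrightarrow> heap (br a b) (br a a) (br b a) = br b b"
    and br_jacobi: "\<lbrakk>a \<in> A; b \<in> A; c \<in> A\<rbrakk> \<Longrightarrow>
          heap (heap (br a (br b c)) (br a a) (br b (br c a))) (br b b) (br c (br a b)) = br c c"

section \<open>The matrices\<close>

definition trace_mat :: "'a::comm_ring_1 mat \<Rightarrow> 'a"
  where "trace_mat a = (\<Sum>i<dim_row a. a $$ (i, i))"

definition sl :: "nat \<Rightarrow> complex mat set"
  where "sl m = {a \<in> carrier_mat m m. trace_mat a = 0}"

text \<open>Matrix indices start at 0.\<close>

definition sna :: "nat \<Rightarrow> complex mat set"
  where "sna n = {a \<in> sl (n + 1).
    \<forall>j<n + 1. (\<Sum>i<n + 1. a $$ (i, j)) = 1 \<and> 1 = (\<Sum>i<n + 1. a $$ (j, i))}"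

end

theory Submission
  imports Defs
begin

text \<open>
  Each axiom of a Lie affgebra becomes an identity in the associative algebra of matrices.
  For the dimension, a tangent vector of \<open>sna n\<close> is a traceless matrix with vanishing row and
  column sums. It is determined by its upper left $n \times n$ block, whose entries are subject
  to the single linear relation that the trace imposes; that relation involves the entry at
  $(0,0)$ with coefficient 2, so the other $n^2 - 1$ entries of the block are free coordinates.
\<close>

section \<open>Dimension from a linear parametrization\<close>

text \<open>\<open>T p\<close> is a linear isomorphism from the standard
  \<open>d\<close>-dimensional space onto the tangent space at \<open>p\<close>, so
  finite-dimensionality and dimension carry over. A family in \<open>p\<close> appears because
  \<open>has_affine_dim\<close> speaks about every base point.\<close>

lemma (in affine_space) has_affine_dim_vecI:
  fixes T :: "'a \<Rightarrow> 'f vec \<Rightarrow> 'a"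
  assumes "A \<noteq> {}"
    and bij: "\<And>p. p \<in> A \<Longrightarrow> bij_betw (T p) (carrier_vec d) A"
    and add: "\<And>p v w. \<lbrakk>p \<in> A; v \<in> carrier_vec d; w \<in> carrier_vec d\<rbrakk> \<Longrightarrow>
      T p (v + w) = heap (T p v) p (T p w)"
    and smult: "\<And>p l v. \<lbrakk>p \<in> A; v \<in> carrier_vec d\<rbrakk> \<Longrightarrow> T p (l \<cdot>\<^sub>v v) = act l p (T p v)"
  shows "has_affine_dim A heap act d"
  unfolding has_affine_dim_def
proof (intro conjI ballI)
  fix p assume p: "p \<in> A"
  let ?V = "module_vec TYPE('f) d" and ?W = "tangent_space A heap act p"
  interpret vs: vec_space "TYPE('f)" d .
  have maps: "T p \<in> carrier_vec d \<rightarrow> A"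
    using bij[OF p] by (auto simp: bij_betw_def)
  have "T p \<in> LinearCombinations.module_hom class_ring ?V ?W"
    unfolding LinearCombinations.module_hom_def using maps add[OF p] smult[OF p]
    by (auto simp: tangent_space_def module_vec_simps)
  then interpret L: linear_map "class_ring :: 'f ring" ?V ?W "T p"
    using vec_vs vectorspace_tangent_space[OF p]
    by (intro linear_map.intro mod_hom.intro mod_hom_axioms.intro) (auto simp: vectorspace_def)
  have inj: "inj_on (T p) (carrier ?V)" and surj: "T p ` carrier ?V = carrier ?W"
    using bij[OF p] by (auto simp: bij_betw_def tangent_space_def module_vec_simps)
  show "vectorspace.fin_dim (class_ring :: 'f ring) ?W"
    by (rule L.surj_fin_dim[OF vs.fin_dim surj])
  show "vectorspace.dim (class_ring :: 'f ring) ?W = d"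
    using L.dim_eq[OF vs.fin_dim inj surj] vs.dim_is_n by simp
qed (fact assms(1))

section \<open>The affine space and the bracket\<close>

lemma mem_sna_iff:
  "a \<in> sna n \<longleftrightarrow> a \<in> carrier_mat (Suc n) (Suc n) \<and> (\<Sum>i<Suc n. a $$ (i, i)) = 0 \<and>
    (\<forall>j<Suc n. (\<Sum>i<Suc n. a $$ (i, j)) = 1) \<and> (\<forall>j<Suc n. (\<Sum>i<Suc n. a $$ (j, i)) = 1)"
  unfolding sna_def sl_def trace_mat_def by (auto simp del: sum.lessThan_Suc)

lemma sna_carrier: "a \<in> sna n \<Longrightarrow> a \<in> carrier_mat (Suc n) (Suc n)"
  by (simp add: mem_sna_iff)

section \<open>Traces and line sums of matrix products\<close>

lemma index_mult_mat_sum: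
  assumes "a \<in> carrier_mat m m" "b \<in> carrier_mat m m" "i < m" "j < m"
  shows "(a * b) $$ (i, j) = (\<Sum>k<m. a $$ (i, k) * b $$ (k, j))"
  using assms by (simp add: scalar_prod_def lessThan_atLeast0)

lemma trace_mult_commute:
  fixes a b :: "'a::comm_ring_1 mat"
  assumes "a \<in> carrier_mat m m" "b \<in> carrier_mat m m"
  shows "(\<Sum>i<m. (a * b) $$ (i, i)) = (\<Sum>i<m. (b * a) $$ (i, i))"
proof -
  have "(\<Sum>i<m. (a * b) $$ (i, i)) = (\<Sum>i<m. \<Sum>k<m. a $$ (i, k) * b $$ (k, i))"
    using assms by (simp add: index_mult_mat_sum del: index_mult_mat(1))
  also have "\<dots> = (\<Sum>k<m. \<Sum>i<m. b $$ (k, i) * a $$ (i, k))"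
    by (subst sum.swap) (simp add: mult.commute)
  also have "\<dots> = (\<Sum>i<m. (b * a) $$ (i, i))"
    using assms by (simp add: index_mult_mat_sum del: index_mult_mat(1))
  finally show ?thesis .
qed

text \<open>With e the all-ones vector, unit row sums of \<open>b\<close> mean that \<open>b\<close>
  fixes e; hence row \<open>i\<close> of \<open>a * b\<close> has the same sum as row
  \<open>i\<close> of \<open>a\<close>.\<close>

lemma row_sum_mult:
  fixes a b :: "'a::comm_ring_1 mat"
  assumes "a \<in> carrier_mat m m" "b \<in> carrier_mat m m" "i < m"
    and "(\<Sum>k<m. a $$ (i, k)) = 1" "\<And>k. k < m \<Longrightarrow> (\<Sum>j<m. b $$ (k, j)) = 1"
  shows "(\<Sum>j<m. (a * b) $$ (i, j)) = 1"
proof -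
  have "(\<Sum>j<m. (a * b) $$ (i, j)) = (\<Sum>j<m. \<Sum>k<m. a $$ (i, k) * b $$ (k, j))"
    using assms by (simp add: index_mult_mat_sum del: index_mult_mat(1))
  also have "\<dots> = (\<Sum>k<m. a $$ (i, k) * (\<Sum>j<m. b $$ (k, j)))"
    by (subst sum.swap) (simp add: sum_distrib_left)
  finally show ?thesis using assms by simp
qed

lemma col_sum_mult:
  fixes a b :: "'a::comm_ring_1 mat"
  assumes "a \<in> carrier_mat m m" "b \<in> carrier_mat m m" "j < m"
    and "(\<Sum>k<m. b $$ (k, j)) = 1" "\<And>k. k < m \<Longrightarrow> (\<Sum>i<m. a $$ (i, k)) = 1"
  shows "(\<Sum>i<m. (a * b) $$ (i, j)) = 1"
proof -
  have "(\<Sum>i<m. (a * b) $$ (i, j)) = (\<Sum>i<m. \<Sum>k<m. a $$ (i, k) * b $$ (k, j))"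
    using assms by (simp add: index_mult_mat_sum del: index_mult_mat(1))
  also have "\<dots> = (\<Sum>k<m. (\<Sum>i<m. a $$ (i, k)) * b $$ (k, j))"
    by (subst sum.swap) (simp add: sum_distrib_right)
  finally show ?thesis using assms by simp
qed

section \<open>Closure under the affine operations and the bracket\<close>

lemma sna_heap_closed:
  assumes "a \<in> sna n" "b \<in> sna n" "c \<in> sna n"
  shows "a - b + c \<in> sna n"
  using assms unfolding mem_sna_iff
  by (auto simp: sum.distrib sum_subtractf simp del: sum.lessThan_Suc)

lemma sna_act_closed:
  assumes "a \<in> sna n" "b \<in> sna n"
  shows "l \<cdot>\<^sub>m b + (1 - l) \<cdot>\<^sub>m a \<in> sna n"
  using assms unfolding mem_sna_iff
  by (auto simp: sum.distrib simp del: sum.lessThan_Suc simp flip: sum_distrib_left)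

text \<open>Both \<open>a * b\<close> and \<open>b * a\<close> have unit line sums, and their traces
  agree. The commutator thus has zero trace and zero line sums, and adding it to \<open>b\<close>
  stays in the set.\<close>

lemma sna_bracket_closed:
  assumes "a \<in> sna n" "b \<in> sna n"
  shows "a * b - b * a + b \<in> sna n"
proof -
  have ab: "a \<in> carrier_mat (Suc n) (Suc n)" "b \<in> carrier_mat (Suc n) (Suc n)"
    using assms by (simp_all add: sna_carrier)
  then show ?thesis
    using assms trace_mult_commute[OF ab] row_sum_mult[OF ab] row_sum_mult[OF ab(2,1)]
      col_sum_mult[OF ab] col_sum_mult[OF ab(2,1)]
    unfolding mem_sna_iff
    by (auto simp: sum.distrib sum_subtractf simp del: sum.lessThan_Suc index_mult_mat(1))
qed

lemma affine_space_sna: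
  "affine_space (sna n) (\<lambda>a b c. a - b + c) (\<lambda>(l::complex) a b. l \<cdot>\<^sub>m b + (1 - l) \<cdot>\<^sub>m a)"
  by (rule affine_space.intro, fact sna_heap_closed, fact sna_act_closed)
    \<comment> \<open>The remaining axioms equate matrices of the same known size and are checked
      entry by entry in the field.\<close>
    ((drule sna_carrier)+, rule eq_matI, auto simp: algebra_simps)+

section \<open>Distributivity over affine combinations, and bi-affinity\<close>

lemma mult_heap_distrib_left:
  fixes a :: "'a::ring mat"
  assumes "a \<in> carrier_mat m m" "b \<in> carrier_mat m m" "c \<in> carrier_mat m m" "d \<in> carrier_mat m m"
  shows "a * (b - c + d) = a * b - a * c + a * d"
  using assms by (simp add: mult_add_distrib_mat[where nr=m and n=m and nc=m]
      mult_minus_distrib_mat[where nr=m and n=m and nc=m] minus_carrier_mat)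

lemma mult_heap_distrib_right:
  fixes a :: "'a::ring mat"
  assumes "a \<in> carrier_mat m m" "b \<in> carrier_mat m m" "c \<in> carrier_mat m m" "d \<in> carrier_mat m m"
  shows "(b - c + d) * a = b * a - c * a + d * a"
  using assms by (simp add: add_mult_distrib_mat[where nr=m and n=m and nc=m]
      minus_mult_distrib_mat[where nr=m and n=m and nc=m] minus_carrier_mat)

lemma mult_lincomb_distrib_left:
  fixes a :: "'a::comm_ring_1 mat"
  assumes "a \<in> carrier_mat m m" "b \<in> carrier_mat m m" "c \<in> carrier_mat m m"
  shows "a * (k \<cdot>\<^sub>m b + l \<cdot>\<^sub>m c) = k \<cdot>\<^sub>m (a * b) + l \<cdot>\<^sub>m (a * c)"
  using assms by (simp add: mult_add_distrib_mat[where nr=m and n=m and nc=m]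
      mult_smult_distrib[where nr=m and n=m and nc=m])

lemma mult_lincomb_distrib_right:
  fixes a :: "'a::comm_ring_1 mat"
  assumes "a \<in> carrier_mat m m" "b \<in> carrier_mat m m" "c \<in> carrier_mat m m"
  shows "(k \<cdot>\<^sub>m b + l \<cdot>\<^sub>m c) * a = k \<cdot>\<^sub>m (b * a) + l \<cdot>\<^sub>m (c * a)"
  using assms by (simp add: add_mult_distrib_mat[where nr=m and n=m and nc=m]
      mult_smult_assoc_mat[where nr=m and n=m and nc=m])

text \<open>The commutator is bilinear. The summand \<open>b\<close> is the identity in the second
  argument and constant in the first; constants are affine because the coefficients in
  \<open>b - b + b\<close> and in \<open>l b + (1 - l) b\<close> add to one.\<close>

lemma bi_affine_bracket_sna:
  "bi_affine (sna n) (\<lambda>a b c. a - b + c) (\<lambda>(l::complex) a b. l \<cdot>\<^sub>m b + (1 - l) \<cdot>\<^sub>m a)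
    (\<lambda>a b. a * b - b * a + b)"
  unfolding bi_affine_def affine_map_def
  by (intro conjI ballI allI Pi_I; (rule sna_bracket_closed; assumption)?; (drule sna_carrier)+;
      simp only: mult_heap_distrib_left[of _ "Suc n"] mult_heap_distrib_right[of _ "Suc n"]
        mult_lincomb_distrib_left[of _ "Suc n"] mult_lincomb_distrib_right[of _ "Suc n"];
      \<comment> \<open>Distributivity has been used up, so entries of products stay atoms and the
        goal is linear in them.\<close>
      rule eq_matI; auto simp: algebra_simps simp del: index_mult_mat(1))

section \<open>The Jacobi identity\<close>

text \<open>All triple products are associated to the right, so that under cyclic permutation equal
  products become syntactically equal and cancel as atoms.\<close>

lemma double_bracket:
  fixes a b c :: "'a::comm_ring_1 mat"
  assumes "a \<in> carrier_mat m m" "b \<in> carrier_mat m m" "c \<in> carrier_mat m m"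
  defines "br \<equiv> \<lambda>a b. a * b - b * a + b"
  shows "br a (br b c) = a * (b * c) - a * (c * b) + a * c - (b * (c * a) - c * (b * a) + c * a)
    + (b * c - c * b + c)"
proof -
  have "a * (b * c - c * b + c) = a * (b * c) - a * (c * b) + a * c"
    using assms(1-3) by (intro mult_heap_distrib_left[of _ m]) auto
  moreover have "(b * c - c * b + c) * a = b * c * a - c * b * a + c * a"
    using assms(1-3) by (intro mult_heap_distrib_right[of _ m]) auto
  moreover have "b * c * a = b * (c * a)" "c * b * a = c * (b * a)"
    using assms(1-3) by (auto intro: assoc_mult_mat)
  ultimately show ?thesis unfolding br_def by simp
qed

text \<open>In terms of commutators, \<open>br a (br b c)\<close> is
  \<open>[a,[b,c]] + [a,c] + [b,c] + c\<close>. In the cyclic sum the double commutators vanish by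
  the usual Jacobi identity and the single ones cancel in pairs; since \<open>br a a = a\<close>,
  the linear terms leave \<open>c\<close>.\<close>

lemma bracket_jacobi:
  fixes a b c :: "'a::comm_ring_1 mat"
  assumes a: "a \<in> carrier_mat m m" and b: "b \<in> carrier_mat m m" and c: "c \<in> carrier_mat m m"
  defines "br \<equiv> \<lambda>a b. a * b - b * a + b"
  shows "br a (br b c) - br a a + br b (br c a) - br b b + br c (br a b) = br c c"
  unfolding br_def double_bracket[OF a b c] double_bracket[OF b c a] double_bracket[OF c a b]
  using a b c by (intro eq_matI) (auto simp del: index_mult_mat(1))

lemma lie_affgebra_sna:
  "lie_affgebra (sna n) (\<lambda>a b c. a - b + c) (\<lambda>(l::complex) a b. l \<cdot>\<^sub>m b + (1 - l) \<cdot>\<^sub>m a)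
    (\<lambda>a b. a * b - b * a + b)"
proof (rule lie_affgebra.intro[OF affine_space_sna
      lie_affgebra_axioms.intro[OF bi_affine_bracket_sna]])
  fix a b assume "a \<in> sna n" "b \<in> sna n"
  note dims = this[THEN sna_carrier]
  \<comment> \<open>The two commutators are opposite and the bracket of \<open>a\<close> with itself
    is \<open>a\<close>, which leaves \<open>b\<close>.\<close>
  show "a * b - b * a + b - (a * a - a * a + a) + (b * a - a * b + a) = b * b - b * b + b"
    using dims by (intro eq_matI) (auto simp del: index_mult_mat(1))
next
  fix a b c assume "a \<in> sna n" "b \<in> sna n" "c \<in> sna n"
  from bracket_jacobi[OF this[THEN sna_carrier]]
  show "a * (b * c - c * b + c) - (b * c - c * b + c) * a + (b * c - c * b + c)
      - (a * a - a * a + a)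
      + (b * (c * a - a * c + a) - (c * a - a * c + a) * b + (c * a - a * c + a))
      - (b * b - b * b + b)
      + (c * (a * b - b * a + b) - (a * b - b * a + b) * c + (a * b - b * a + b))
      = c * c - c * c + c" .
qed

section \<open>Coordinates\<close>

text \<open>The witness is the permutation matrix of the cyclic shift. Permutation matrices have
  unit line sums, and for \<open>n >= 1\<close> the shift has no fixed point, so the trace is
  zero.\<close>

lemma sna_nonempty:
  assumes "n \<ge> 1"
  shows "sna n \<noteq> {}"
proof -
  let ?m = "Suc n"
  let ?P = "mat ?m ?m (\<lambda>(i, j). if j = Suc i mod ?m then 1 else 0) :: complex mat"
  let ?pred = "\<lambda>j. if j = 0 then n else j - 1"
  \<comment> \<open>\<open>?pred\<close> inverts the shift and thereby locates the only nonzero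
    entry of a column.\<close>
  have pred: "j = Suc i mod ?m \<longleftrightarrow> i = ?pred j" if "i < ?m" "j < ?m" for i j
    using that by (cases "i = n") auto
  have "(\<Sum>i<?m. ?P $$ (i, j)) = 1" if "j < ?m" for j
  proof -
    have "(\<Sum>i<?m. ?P $$ (i, j)) = (\<Sum>i<?m. if i = ?pred j then 1 else 0)"
      using that by (intro sum.cong) (auto simp: pred)
    also have "\<dots> = 1" using that by (subst sum.delta) auto
    finally show ?thesis .
  qed
  moreover have "(\<Sum>j<?m. ?P $$ (i, j)) = 1" if "i < ?m" for i
  proof -
    have "(\<Sum>j<?m. ?P $$ (i, j)) = (\<Sum>j<?m. if j = Suc i mod ?m then 1 else 0)"
      using that by (intro sum.cong) auto
    also have "\<dots> = 1" by (subst sum.delta) auto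
    finally show ?thesis .
  qed
  moreover have "(\<Sum>i<?m. ?P $$ (i, i)) = 0"
  proof (intro sum.neutral ballI)
    fix i assume "i \<in> {..<?m}"
    then show "?P $$ (i, i) = 0" using assms by (cases "i = n") auto
  qed
  ultimately have "?P \<in> sna n" unfolding mem_sna_iff by auto
  then show ?thesis by blast
qed

section \<open>Tangent matrices and their coordinates\<close>

text \<open>This is the vector \<open>e_i - e_n\<close> on the indices 0 to \<open>n\<close>; for
  \<open>i < n\<close> these vectors form a basis of the zero-sum vectors.\<close>

definition diff_unit :: "nat \<Rightarrow> nat \<Rightarrow> nat \<Rightarrow> complex"
  where "diff_unit n i r = (if r = i then 1 else if r = n then -1 else 0)"

lemma sum_diff_unit: "i < n \<Longrightarrow> (\<Sum>r<Suc n. diff_unit n i r) = 0"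
proof -
  assume "i < n"
  then have "(\<Sum>r<n. diff_unit n i r) = (\<Sum>r<n. if r = i then 1 else 0)"
    by (intro sum.cong) (auto simp: diff_unit_def)
  then show ?thesis using \<open>i < n\<close> by (simp add: diff_unit_def)
qed

text \<open>This is the trace of an outer product of difference vectors: the common
  \<open>-1\<close> at \<open>n\<close> always contributes 1, and the entries \<open>1\<close> meet
  only if \<open>i = j\<close>.\<close>

lemma sum_diff_unit_mult:
  assumes "i < n" "j < n"
  shows "(\<Sum>r<Suc n. diff_unit n i r * diff_unit n j r) = (if i = j then 2 else 1)"
proof -
  have "(\<Sum>r<n. diff_unit n i r * diff_unit n j r) = (\<Sum>r<n. if r = i then if i = j then 1 else 0 else 0)"
    using assms by (intro sum.cong) (auto simp: diff_unit_def)
  then show ?thesis using assms by (simp add: diff_unit_def)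
qed

text \<open>
  The index \<open>k < n\<^sup>2 - 1\<close> stands for the position \<open>(Suc k div n, Suc k mod n)\<close>, which
  runs through the block except for \<open>(0, 0)\<close>. The second summand makes the trace vanish.
\<close>

definition tangent_unit :: "nat \<Rightarrow> nat \<Rightarrow> nat \<Rightarrow> nat \<Rightarrow> complex"
  where "tangent_unit n k r s =
    diff_unit n (Suc k div n) r * diff_unit n (Suc k mod n) s -
    (if Suc k div n = Suc k mod n then 1 else 1 / 2) * (diff_unit n 0 r * diff_unit n 0 s)"

definition tangent_mat :: "nat \<Rightarrow> complex vec \<Rightarrow> complex mat"
  where "tangent_mat n v =
    mat (Suc n) (Suc n) (\<lambda>(r, s). \<Sum>k<n\<^sup>2 - 1. v $ k * tangent_unit n k r s)"

lemma position_bounds: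
  assumes "k < n\<^sup>2 - 1"
  shows "Suc k div n < n" "Suc k mod n < n" "0 < n"
proof -
  have "Suc k < n * n" using assms by (simp add: power2_eq_square)
  then show "Suc k div n < n" by (rule less_mult_imp_div_less)
  show "0 < n" using assms by (cases n) auto
  then show "Suc k mod n < n" by simp
qed

text \<open>Quotient and remainder recover \<open>Suc k\<close>, which is positive: the shift by one
  is what skips the corner.\<close>

lemma position_nonzero: "Suc k div n \<noteq> 0 \<or> Suc k mod n \<noteq> 0"
proof (rule ccontr)
  assume "\<not> ?thesis"
  then have "Suc k div n * n + Suc k mod n = 0" by (simp only: de_Morgan_disj not_not mult_zero_left add_0)
  then show False unfolding div_mult_mod_eq by simp
qed

lemma position_inj:
  assumes "Suc k div n = Suc l div n" "Suc k mod n = Suc l mod n"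
  shows "k = l"
proof -
  have "Suc k div n * n + Suc k mod n = Suc l div n * n + Suc l mod n"
    by (simp only: assms)
  then show ?thesis unfolding div_mult_mod_eq by simp
qed

text \<open>The witness is the row-major number \<open>i * n + j\<close>, lowered by one. Away from
  the corner this number is positive, so the subtraction on naturals is exact.\<close>

lemma position_surj:
  assumes "i < n" "j < n" "i \<noteq> 0 \<or> j \<noteq> 0"
  obtains k where "k < n\<^sup>2 - 1" "Suc k div n = i" "Suc k mod n = j"
proof
  have pos: "0 < i * n + j" using assms by auto
  have "Suc i * n \<le> n * n" using assms by (intro mult_le_mono) auto
  then have "i * n + j < n\<^sup>2" using assms unfolding power2_eq_square by auto
  then show "i * n + j - 1 < n\<^sup>2 - 1" using pos by linarith
  show "Suc (i * n + j - 1) div n = i" "Suc (i * n + j - 1) mod n = j"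
    using pos assms by simp_all
qed

text \<open>Outer products of zero-sum vectors have zero line sums. The trace is
  \<open>2 - 1 * 2\<close> for a diagonal position and \<open>1 - (1 / 2) * 2\<close>
  otherwise.\<close>

lemma tangent_unit_sums:
  assumes k: "k < n\<^sup>2 - 1"
  shows "(\<Sum>r<Suc n. tangent_unit n k r s) = 0"
    and "(\<Sum>s<Suc n. tangent_unit n k r s) = 0"
    and "(\<Sum>r<Suc n. tangent_unit n k r r) = 0"
proof -
  note b = position_bounds[OF k]
  show "(\<Sum>r<Suc n. tangent_unit n k r s) = 0"
    using b unfolding tangent_unit_def
    by (simp add: sum_subtractf sum_diff_unit del: sum.lessThan_Suc
        flip: sum_distrib_left sum_distrib_right)
  show "(\<Sum>s<Suc n. tangent_unit n k r s) = 0"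
    using b unfolding tangent_unit_def
    by (simp add: sum_subtractf sum_diff_unit del: sum.lessThan_Suc
        flip: sum_distrib_left sum_distrib_right)
  show "(\<Sum>r<Suc n. tangent_unit n k r r) = 0"
    using b unfolding tangent_unit_def
    by (simp add: sum_subtractf sum_diff_unit_mult del: sum.lessThan_Suc flip: sum_distrib_left)
qed

text \<open>The entries at the enumerated positions are functionals dual to the tangent units:
  inside the block \<open>diff_unit\<close> is a Kronecker delta, and the trace correction lives
  only at the corner there.\<close>

lemma tangent_unit_position:
  assumes k: "k < n\<^sup>2 - 1" and l: "l < n\<^sup>2 - 1"
  shows "tangent_unit n k (Suc l div n) (Suc l mod n) = (if k = l then 1 else 0)"
proof -
  have block: "diff_unit n i r = (if r = i then 1 else 0)" if "r < n" for i r
    using that by (simp add: diff_unit_def)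
  have eq: "k = l \<longleftrightarrow> Suc l div n = Suc k div n \<and> Suc l mod n = Suc k mod n"
    by (metis position_inj)
  have "diff_unit n 0 (Suc l div n) * diff_unit n 0 (Suc l mod n) = 0"
    using position_nonzero[of l n] position_bounds[OF l]
    by (elim disjE) (simp_all only: block if_False mult_zero_left mult_zero_right)
  moreover have "diff_unit n (Suc k div n) (Suc l div n) * diff_unit n (Suc k mod n) (Suc l mod n)
      = (if k = l then 1 else 0)"
    unfolding eq using position_bounds[OF l]
    by (simp only: block mult_1 mult_zero_left simp_thms split: if_split) blast
  ultimately show ?thesis unfolding tangent_unit_def by (simp only: mult_zero_right diff_zero)
qed

lemma tangent_mat_carrier [simp]: "tangent_mat n v \<in> carrier_mat (Suc n) (Suc n)"
  by (simp add: tangent_mat_def)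

lemma tangent_mat_index:
  assumes "r < Suc n" "s < Suc n"
  shows "tangent_mat n v $$ (r, s) = (\<Sum>k<n\<^sup>2 - 1. v $ k * tangent_unit n k r s)"
  using assms by (simp add: tangent_mat_def)

lemma tangent_mat_sums:
  shows "s < Suc n \<Longrightarrow> (\<Sum>r<Suc n. tangent_mat n v $$ (r, s)) = 0"
    and "r < Suc n \<Longrightarrow> (\<Sum>s<Suc n. tangent_mat n v $$ (r, s)) = 0"
    and "(\<Sum>r<Suc n. tangent_mat n v $$ (r, r)) = 0"
proof -
  show "(\<Sum>r<Suc n. tangent_mat n v $$ (r, s)) = 0" if "s < Suc n"
    using that by (simp add: tangent_mat_index del: sum.lessThan_Suc)
      (subst sum.swap, simp add: tangent_unit_sums del: sum.lessThan_Suc flip: sum_distrib_left)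
  show "(\<Sum>s<Suc n. tangent_mat n v $$ (r, s)) = 0" if "r < Suc n"
    using that by (simp add: tangent_mat_index del: sum.lessThan_Suc)
      (subst sum.swap, simp add: tangent_unit_sums del: sum.lessThan_Suc flip: sum_distrib_left)
  show "(\<Sum>r<Suc n. tangent_mat n v $$ (r, r)) = 0"
    by (simp add: tangent_mat_index del: sum.lessThan_Suc)
      (subst sum.swap, simp add: tangent_unit_sums del: sum.lessThan_Suc flip: sum_distrib_left)
qed

text \<open>By this duality the coefficients can be read off as entries, which yields injectivity
  and dictates the preimage in the surjectivity proof.\<close>

lemma tangent_mat_position:
  assumes "l < n\<^sup>2 - 1"
  shows "tangent_mat n v $$ (Suc l div n, Suc l mod n) = v $ l"
proof -
  have "tangent_mat n v $$ (Suc l div n, Suc l mod n) =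
      (\<Sum>k<n\<^sup>2 - 1. if k = l then v $ k else 0)"
    using position_bounds[OF assms]
    by (subst tangent_mat_index) (auto simp: tangent_unit_position assms less_SucI intro!: sum.cong
        simp del: One_nat_def sum.delta sum.delta')
  then show ?thesis using assms by simp
qed

section \<open>Bijectivity of the parametrization\<close>

text \<open>Put x = \<open>D 0 0\<close>. The sums of row 0 and column 0 force \<open>-x\<close> at
  their ends, the other border entries before \<open>D n n\<close> vanish, and the last column then
  gives \<open>D n n = x\<close>. The trace is therefore 2x, so x = 0.\<close>

lemma zero_sums_determined_by_block:
  fixes D :: "nat \<Rightarrow> nat \<Rightarrow> complex"
  assumes "0 < n"
    and col: "\<And>s. s \<le> n \<Longrightarrow> (\<Sum>r<Suc n. D r s) = 0"
    and row: "\<And>r. r \<le> n \<Longrightarrow> (\<Sum>s<Suc n. D r s) = 0"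
    and trace: "(\<Sum>r<Suc n. D r r) = 0"
    and block: "\<And>i j. \<lbrakk>i < n; j < n; i \<noteq> 0 \<or> j \<noteq> 0\<rbrakk> \<Longrightarrow> D i j = 0"
    and "r \<le> n" "s \<le> n"
  shows "D r s = 0"
proof -
  have D: "D i j = (if i = 0 \<and> j = 0 then D 0 0 else 0)" if "i < n" "j < n" for i j
    using that block by auto
  have rn: "D i n = (if i = 0 then - D 0 0 else 0)" if "i < n" for i
  proof -
    have "(\<Sum>s<n. D i s) = (\<Sum>s<n. if s = 0 then if i = 0 then D 0 0 else 0 else 0)"
      using that by (intro sum.cong) (auto simp: D)
    then show ?thesis using row[of i] that by (auto simp: add_eq_0_iff2)
  qed
  have nc: "D n j = (if j = 0 then - D 0 0 else 0)" if "j < n" for j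
  proof -
    have "(\<Sum>r<n. D r j) = (\<Sum>r<n. if r = 0 then if j = 0 then D 0 0 else 0 else 0)"
      using that by (intro sum.cong) (auto simp: D)
    then show ?thesis using col[of j] that by (auto simp: add_eq_0_iff2)
  qed
  have "(\<Sum>r<n. D r n) = (\<Sum>r<n. if r = 0 then - D 0 0 else 0)"
    by (intro sum.cong) (auto simp: rn)
  then have nn: "D n n = D 0 0" using col[of n] \<open>0 < n\<close> by simp
  have "(\<Sum>r<n. D r r) = (\<Sum>r<n. if r = 0 then D 0 0 else 0)"
    by (intro sum.cong) (auto simp: D)
  then have "D 0 0 = 0" using trace nn \<open>0 < n\<close> by simp
  then show ?thesis
    using D[of r s] rn[of r] nc[of s] nn \<open>r \<le> n\<close> \<open>s \<le> n\<close> by (cases "r = n"; cases "s = n") auto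
qed

lemma bij_betw_tangent_mat:
  assumes n: "n \<ge> 1" and p: "p \<in> sna n"
  shows "bij_betw (\<lambda>v. p + tangent_mat n v) (carrier_vec (n\<^sup>2 - 1)) (sna n)"
  unfolding bij_betw_def
proof (intro conjI equalityI subsetI)
  note pc = sna_carrier[OF p]
  show "inj_on (\<lambda>v. p + tangent_mat n v) (carrier_vec (n\<^sup>2 - 1))"
  proof (rule inj_onI)
    fix v w assume vw: "v \<in> carrier_vec (n\<^sup>2 - 1)" "w \<in> carrier_vec (n\<^sup>2 - 1)"
      and eq: "p + tangent_mat n v = p + tangent_mat n w"
    show "v = w"
    proof (rule eq_vecI)
      fix l assume "l < dim_vec w"
      then have l: "l < n\<^sup>2 - 1" using vw by simp
      have "(p + tangent_mat n v) $$ (Suc l div n, Suc l mod n) =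
          (p + tangent_mat n w) $$ (Suc l div n, Suc l mod n)"
        by (simp only: eq)
      then show "v $ l = w $ l"
        using position_bounds[OF l] pc tangent_mat_carrier[of n v] tangent_mat_carrier[of n w]
        by (simp add: tangent_mat_position[OF l] less_Suc_eq del: tangent_mat_carrier)
    qed (use vw in simp)
  qed
  show "x \<in> sna n" if "x \<in> (\<lambda>v. p + tangent_mat n v) ` carrier_vec (n\<^sup>2 - 1)" for x
  proof -
    obtain v where "x = p + tangent_mat n v" using \<open>x \<in> _\<close> by blast
    then show ?thesis
      using p tangent_mat_carrier[of n v] unfolding mem_sna_iff
      by (auto simp: sum.distrib tangent_mat_sums simp del: sum.lessThan_Suc tangent_mat_carrier)
  qed
  show "x \<in> (\<lambda>v. p + tangent_mat n v) ` carrier_vec (n\<^sup>2 - 1)" if x: "x \<in> sna n" for x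
  proof
    \<comment> \<open>The coordinates of the displacement \<open>x - p\<close> are its entries at
      the enumerated positions; \<open>D\<close> is the error that remains.\<close>
    define v where "v = vec (n\<^sup>2 - 1) (\<lambda>k. x $$ (Suc k div n, Suc k mod n) - p $$ (Suc k div n, Suc k mod n))"
    define D where "D r s = x $$ (r, s) - p $$ (r, s) - tangent_mat n v $$ (r, s)" for r s
    show "v \<in> carrier_vec (n\<^sup>2 - 1)" by (simp add: v_def)
    have D0: "D r s = 0" if "r \<le> n" "s \<le> n" for r s
    proof (rule zero_sums_determined_by_block[OF _ _ _ _ _ that])
      show "0 < n" using n by simp
      show "(\<Sum>r<Suc n. D r s) = 0" if "s \<le> n" for s
        using that x p unfolding mem_sna_iff D_def
        by (simp add: sum_subtractf tangent_mat_sums del: sum.lessThan_Suc)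
      show "(\<Sum>s<Suc n. D r s) = 0" if "r \<le> n" for r
        using that x p unfolding mem_sna_iff D_def
        by (simp add: sum_subtractf tangent_mat_sums del: sum.lessThan_Suc)
      show "(\<Sum>r<Suc n. D r r) = 0"
        using x p unfolding mem_sna_iff D_def
        by (simp add: sum_subtractf tangent_mat_sums del: sum.lessThan_Suc)
      show "D i j = 0" if ij: "i < n" "j < n" "i \<noteq> 0 \<or> j \<noteq> 0" for i j
      proof -
        obtain k where k: "k < n\<^sup>2 - 1" "Suc k div n = i" "Suc k mod n = j"
          using position_surj[OF ij] .
        then show ?thesis
          using tangent_mat_position[OF k(1), of v] by (simp add: D_def v_def)
      qed
    qed
    show "x = p + tangent_mat n v"
    proof (rule eq_matI)
      fix r s assume rs: "r < dim_row (p + tangent_mat n v)" "s < dim_col (p + tangent_mat n v)"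
      then have "r \<le> n" "s \<le> n" using tangent_mat_carrier[of n v] by auto
      with D0[of r s] rs show "x $$ (r, s) = (p + tangent_mat n v) $$ (r, s)"
        by (simp add: D_def algebra_simps)
    qed (use carrier_matD[OF sna_carrier[OF x]] carrier_matD[OF tangent_mat_carrier[of n v]] in simp_all)
  qed
qed

lemma tangent_mat_add:
  assumes "v \<in> carrier_vec (n\<^sup>2 - 1)" "w \<in> carrier_vec (n\<^sup>2 - 1)"
  shows "tangent_mat n (v + w) = tangent_mat n v + tangent_mat n w"
  using assms by (intro eq_matI) (auto simp: tangent_mat_def sum.distrib algebra_simps)

lemma tangent_mat_smult:
  assumes "v \<in> carrier_vec (n\<^sup>2 - 1)"
  shows "tangent_mat n (l \<cdot>\<^sub>v v) = l \<cdot>\<^sub>m tangent_mat n v"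
  using assms by (intro eq_matI) (auto simp: tangent_mat_def sum_distrib_left algebra_simps)

lemma has_affine_dim_sna:
  assumes n: "n \<ge> 1"
  shows "has_affine_dim (sna n) (\<lambda>a b c. a - b + c)
    (\<lambda>(l::complex) a b. l \<cdot>\<^sub>m b + (1 - l) \<cdot>\<^sub>m a) (n\<^sup>2 - 1)"
proof (rule affine_space.has_affine_dim_vecI[OF affine_space_sna sna_nonempty[OF n]
      bij_betw_tangent_mat[OF n]])
  fix p :: "complex mat" and v w :: "complex vec" and l :: complex
  assume p: "p \<in> sna n" and v: "v \<in> carrier_vec (n\<^sup>2 - 1)"
  have dims: "dim_row p = Suc n" "dim_col p = Suc n" "\<And>u. dim_row (tangent_mat n u) = Suc n"
      "\<And>u. dim_col (tangent_mat n u) = Suc n"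
    using sna_carrier[OF p] by (auto simp: tangent_mat_def)
  \<comment> \<open>Addition in the tangent space at \<open>p\<close> is ordinary addition of
    displacements from \<open>p\<close>.\<close>
  show "p + tangent_mat n (v + w) = p + tangent_mat n v - p + (p + tangent_mat n w)"
    if "w \<in> carrier_vec (n\<^sup>2 - 1)"
    unfolding tangent_mat_add[OF v that] by (intro eq_matI) (auto simp: dims)
  \<comment> \<open>Likewise the action based at \<open>p\<close> scales the displacement, as
    \<open>l p + (1 - l) p = p\<close>.\<close>
  show "p + tangent_mat n (l \<cdot>\<^sub>v v) = l \<cdot>\<^sub>m (p + tangent_mat n v) + (1 - l) \<cdot>\<^sub>m p"
    unfolding tangent_mat_smult[OF v] by (intro eq_matI) (auto simp: dims algebra_simps)
qed

theorem proposition4p1: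
  fixes n :: nat
  assumes "n \<ge> 1"
  shows "lie_affgebra (sna n)
           (\<lambda>a b c. a - b + c)
           (\<lambda>(l::complex) a b. l \<cdot>\<^sub>m b + (1 - l) \<cdot>\<^sub>m a)
           (\<lambda>a b. a * b - b * a + b)
       \<and> has_affine_dim (sna n)
           (\<lambda>a b c. a - b + c)
           (\<lambda>(l::complex) a b. l \<cdot>\<^sub>m b + (1 - l) \<cdot>\<^sub>m a)
           (n\<^sup>2 - 1)"
  using lie_affgebra_sna has_affine_dim_sna[OF assms] by blast

end
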